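(* Let $n,k\geq 1$ and suppose that a group morphism $\psi=(\phi_1,\ldots,\phi_n;\sigma):\mathbb{Z}^k\to (\mathbb{Z}^k)^n\rtimes \Sigma_n$ is induced by an affine map. If $\bar z\in\mathbb{Z}^k$ and $(i_1\ldots i_m)$ is a non-trivial cycle (i.e. $m\geq 2$) in the disjoint cycle decomposition of $\sigma_{\bar z}$, then the images $\phi_{i_1}(\bar z),\ldots,\phi_{i_m}(\bar z)$ cannot all be equal.
   Context: $\Sigma_n$ is the symmetric group on $\{1,\ldots,n\}$. The product in $(\mathbb{Z}^k)^n\rtimes\Sigma_n$ is $(\alpha_1,\ldots,\alpha_n;\sigma)(\beta_1,\ldots,\beta_n;\tau)=(\alpha_1+\beta_{\sigma^{-1}(1)},\ldots,\alpha_n+\beta_{\sigma^{-1}(n)};\sigma\tau)$. A group morphism $\psi:\mathbb{Z}^k\to(\mathbb{Z}^k)^n\rtimes\Sigma_n$ is written $\psi=(\phi_1,\ldots,\phi_n;\sigma)$, meaning $\psi(\bar z)=(\phi_1(\bar z),\ldots,\phi_n(\bar z);\sigma_{\bar z})$; here $\sigma:\bar z\mapsto\sigma_{\bar z}\in\Sigma_n$ is a morphism, and the $\phi_i:\mathbb{Z}^k\to\mathbb{Z}^k$ are maps, not necessarily morphisms. $T^k$ is the $k$-torus with universal covering $p:\mathbb{R}^k\to T^k$, $p(t_1,\ldots,t_k)=(e^{2\pi i t_1},\ldots,e^{2\pi i t_k})$, and covering group $\mathbb{Z}^k$ acting by translations. $D_n(T^k)$ is the space of sets of $n$ distinct points of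 $T^k$, topologised as the quotient of the ordered configuration space $F_n(T^k)\subseteq (T^k)^n$ by the permutation action of $\Sigma_n$; an $n$-valued map of $T^k$ is a continuous map $f:T^k\to D_n(T^k)$. Let $F_n(\mathbb{R}^k,\mathbb{Z}^k)=\{(\tilde x_1,\ldots,\tilde x_n)\in(\mathbb{R}^k)^n\mid p(\tilde x_i)\neq p(\tilde x_j)\text{ if }i\neq j\}$, with covering map $p^n:F_n(\mathbb{R}^k,\mathbb{Z}^k)\to D_n(T^k)$, $(\tilde x_1,\ldots,\tilde x_n)\mapsto\{p(\tilde x_1),\ldots,p(\tilde x_n)\}$. A lift of $f$ is a continuous map $\tilde f=(\tilde f_1,\ldots,\tilde f_n):\mathbb{R}^k\to F_n(\mathbb{R}^k,\mathbb{Z}^k)$ with $p^n\circ\tilde f=f\circ p$; the maps $\tilde f_i:\mathbb{R}^k\to\mathbb{R}^k$ are its lift-factors. A lift $\tilde f$ induces a unique morphism $\psi_{\tilde f}=(\phi_1,\ldots,\phi_n;\sigma):\mathbb{Z}^k\to(\mathbb{Z}^k)^n\rtimes\Sigma_n$ satisfying $\tilde f_i(\bar t+\bar z)=\tilde f_{(\sigma_{\bar z})^{-1}(i)}(\bar t)+\phi_i(\bar z)$ for all $i$, all $\bar t\in\mathbb{R}^k$ and all $\bar z\in\mathbb{Z}^k$. The map $f$ is affine if it has a lift all of whose lift-factors are affine maps $\bar t\mapsto A_i\bar t+\bar a_i$ with $A_i\in\mathbb{R}^{k\times k}$, $\bar a_i\in\mathbb{R}^k$. A morphism $\psi$ is induced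 by an affine ($n$-valued) map if there is an affine $f:T^k\to D_n(T^k)$ and a lift $\tilde f$ of $f$ with $\psi_{\tilde f}=\psi$. *)

theory Defs
  imports "HOL-Analysis.Analysis" "HOL-Algebra.Sym_Groups"
begin

section \<open>The groups\<close>

text \<open>
  The rank \<open>k\<close> is the cardinality of the index type \<open>'k\<close>. An \<open>n\<close>-tuple is a function on
  \<open>{1..n}\<close>, extended by \<open>undefined\<close> outside (an element of a \<open>PiE\<close>).
\<close>

definition int_lattice :: "(int ^ 'k) monoid" where
  "int_lattice = \<lparr>carrier = UNIV, mult = (+), one = 0\<rparr>"

definition int_lattice_wr_sym :: "nat \<Rightarrow> ((nat \<Rightarrow> int ^ 'k) \<times> (nat \<Rightarrow> nat)) monoid" where
  "int_lattice_wr_sym n =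
     \<lparr>carrier = ({1..n} \<rightarrow>\<^sub>E UNIV) \<times> carrier (sym_group n),
      mult = (\<lambda>(\<alpha>, \<sigma>) (\<beta>, \<tau>). (\<lambda>i\<in>{1..n}. \<alpha> i + \<beta> (inv' \<sigma> i), \<sigma> \<otimes>\<^bsub>sym_group n\<^esub> \<tau>)),
      one = (\<lambda>i\<in>{1..n}. 0, \<one>\<^bsub>sym_group n\<^esub>)\<rparr>"

lemma group_int_lattice: "group (int_lattice :: (int ^ 'k) monoid)"
proof (rule groupI)
  fix x :: "int ^ 'k"
  show "\<exists>y\<in>carrier int_lattice. y \<otimes>\<^bsub>int_lattice\<^esub> x = \<one>\<^bsub>int_lattice\<^esub>"
    by (rule bexI[of _ "- x"]) (auto simp: int_lattice_def)
qed (auto simp: int_lattice_def add.assoc)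

lemma group_int_lattice_wr_sym:
  "group (int_lattice_wr_sym n :: ((nat \<Rightarrow> int ^ 'k) \<times> (nat \<Rightarrow> nat)) monoid)"
  (is "group ?G")
proof (rule groupI)
  have carrier: "x \<in> carrier ?G \<longleftrightarrow> fst x \<in> extensional {1..n} \<and> snd x permutes {1..n}" for x
    by (cases x) (simp add: int_lattice_wr_sym_def sym_group_def PiE_def)
  have mult: "x \<otimes>\<^bsub>?G\<^esub> y = (\<lambda>i\<in>{1..n}. fst x i + fst y (inv' (snd x) i), snd x \<circ> snd y)" for x y
    by (cases x; cases y) (simp add: int_lattice_wr_sym_def sym_group_def)
  have one: "\<one>\<^bsub>?G\<^esub> = (\<lambda>i\<in>{1..n}. 0, id)"
    by (simp add: int_lattice_wr_sym_def sym_group_def)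
  have inv_in: "inv' \<sigma> i \<in> {1..n}" if "\<sigma> permutes {1..n}" "i \<in> {1..n}" for \<sigma> i
    using permutes_in_image[OF permutes_inv[OF that(1)]] that(2) by blast
  show "x \<otimes>\<^bsub>?G\<^esub> y \<in> carrier ?G" if "x \<in> carrier ?G" "y \<in> carrier ?G" for x y
    using that unfolding carrier mult by (simp add: permutes_compose)
  show "\<one>\<^bsub>?G\<^esub> \<in> carrier ?G"
    unfolding carrier one by (simp add: permutes_id)
  show "(x \<otimes>\<^bsub>?G\<^esub> y) \<otimes>\<^bsub>?G\<^esub> z = x \<otimes>\<^bsub>?G\<^esub> (y \<otimes>\<^bsub>?G\<^esub> z)"
    if "x \<in> carrier ?G" "y \<in> carrier ?G" "z \<in> carrier ?G" for x y z
  proof -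
    have s: "snd x permutes {1..n}" and t: "snd y permutes {1..n}"
      using that unfolding carrier by auto
    have st: "inv' (snd x \<circ> snd y) = inv' (snd y) \<circ> inv' (snd x)"
      by (rule o_inv_distrib[OF permutes_bij[OF s] permutes_bij[OF t]])
    have "fst ((x \<otimes>\<^bsub>?G\<^esub> y) \<otimes>\<^bsub>?G\<^esub> z) i = fst (x \<otimes>\<^bsub>?G\<^esub> (y \<otimes>\<^bsub>?G\<^esub> z)) i" for i
      using inv_in[OF s, of i] unfolding mult fst_conv snd_conv st
      by (simp add: restrict_def add.assoc)
    moreover have "snd ((x \<otimes>\<^bsub>?G\<^esub> y) \<otimes>\<^bsub>?G\<^esub> z) = snd (x \<otimes>\<^bsub>?G\<^esub> (y \<otimes>\<^bsub>?G\<^esub> z))"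
      unfolding mult by (simp add: comp_assoc)
    ultimately show ?thesis by (intro prod_eqI ext) auto
  qed
  show "\<one>\<^bsub>?G\<^esub> \<otimes>\<^bsub>?G\<^esub> x = x" if "x \<in> carrier ?G" for x
  proof (rule prod_eqI)
    show "fst (\<one>\<^bsub>?G\<^esub> \<otimes>\<^bsub>?G\<^esub> x) = fst x"
      using that unfolding carrier mult one
      by (simp add: inv_id restrict_def extensional_def fun_eq_iff)
  qed (simp add: mult one)
  show "\<exists>y\<in>carrier ?G. y \<otimes>\<^bsub>?G\<^esub> x = \<one>\<^bsub>?G\<^esub>" if "x \<in> carrier ?G" for x
  proof
    have s: "snd x permutes {1..n}" using that unfolding carrier by simp
    let ?y = "(\<lambda>i\<in>{1..n}. - fst x (snd x i), inv' (snd x))"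
    show "?y \<in> carrier ?G" using permutes_inv[OF s] unfolding carrier by simp
    show "?y \<otimes>\<^bsub>?G\<^esub> x = \<one>\<^bsub>?G\<^esub>"
      unfolding mult one fst_conv snd_conv permutes_inv_inv[OF s] permutes_inv_o(2)[OF s]
      by (simp add: restrict_def fun_eq_iff)
  qed
qed


section \<open>The torus and its configuration spaces\<close>

definition torus :: "(complex ^ 'k) set" where
  "torus = {w. \<forall>j. norm (w $ j) = 1}"

definition torus_cover :: "real ^ 'k \<Rightarrow> complex ^ 'k" where
  "torus_cover t = (\<chi> j. exp (2 * complex_of_real pi * \<i> * complex_of_real (t $ j)))"

definition ordered_config :: "nat \<Rightarrow> (nat \<Rightarrow> complex ^ 'k) topology" where
  "ordered_config n =
     subtopology (product_topology (\<lambda>_. top_of_set torus) {1..n}) {x. inj_on x {1..n}}"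

definition config_set :: "nat \<Rightarrow> (complex ^ 'k) set set" where
  "config_set n = {S. S \<subseteq> torus \<and> finite S \<and> card S = n}"

text \<open>The quotient topology along \<open>x \<mapsto> {x\<^sub>1, \<dots>, x\<^sub>n}\<close>, whose fibres are the orbits of the
  symmetric group; see \<open>quotient_map_config\<close> below.\<close>

definition config :: "nat \<Rightarrow> (complex ^ 'k) set topology" where
  "config n = topology (\<lambda>U. U \<subseteq> config_set n \<and>
     openin (ordered_config n) {x \<in> topspace (ordered_config n). x ` {1..n} \<in> U})"

lemma openin_config:
  fixes U :: "(complex ^ 'k) set set"
  shows "openin (config n) U \<longleftrightarrow> U \<subseteq> config_set n \<and>
     openin (ordered_config n) {x \<in> topspace (ordered_config n). x ` {1..n} \<in> U}"
proof -
  let ?X = "ordered_config n :: (nat \<Rightarrow> complex ^ 'k) topology"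
  let ?pre = "\<lambda>U. {x \<in> topspace ?X. x ` {1..n} \<in> U}"
  have "istopology (\<lambda>U. U \<subseteq> config_set n \<and> openin ?X (?pre U))"
    unfolding istopology_def
  proof (intro conjI allI impI; (elim conjE)?)
    fix S T :: "(complex ^ 'k) set set"
    assume "openin ?X (?pre S)" "openin ?X (?pre T)"
    then have "openin ?X (?pre S \<inter> ?pre T)" by (rule openin_Int)
    also have "?pre S \<inter> ?pre T = ?pre (S \<inter> T)" by auto
    finally show "openin ?X (?pre (S \<inter> T))" .
  next
    fix K :: "(complex ^ 'k) set set set"
    assume "\<forall>U\<in>K. U \<subseteq> config_set n \<and> openin ?X (?pre U)"
    then have "openin ?X (\<Union>U\<in>K. ?pre U)" by blast
    also have "(\<Union>U\<in>K. ?pre U) = ?pre (\<Union>K)" by auto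
    finally show "openin ?X (?pre (\<Union>K))" .
  qed auto
  then show ?thesis
    unfolding config_def by (simp only: topology_inverse')
qed

lemma topspace_ordered_config:
  "topspace (ordered_config n) = {x \<in> {1..n} \<rightarrow>\<^sub>E torus. inj_on x {1..n}}"
  by (simp add: ordered_config_def Int_def)

lemma image_ordered_config:
  "(\<lambda>x. x ` {1..n}) ` topspace (ordered_config n) = config_set n"
proof (intro equalityI subsetI)
  fix S :: "(complex ^ 'k) set"
  assume "S \<in> (\<lambda>x. x ` {1..n}) ` topspace (ordered_config n)"
  then show "S \<in> config_set n"
    by (auto simp: topspace_ordered_config config_set_def card_image)
next
  fix S :: "(complex ^ 'k) set"
  assume S: "S \<in> config_set n"
  then have "finite S" "card {1..n} = card S"
    by (simp_all add: config_set_def)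
  then have "\<exists>h. bij_betw h {1..n} S"
    by (rule finite_same_card_bij[OF finite_atLeastAtMost])
  then obtain h where h: "bij_betw h {1..n} S" ..
  have "h i \<in> torus" if "i \<in> {1..n}" for i
    using bij_betw_apply[OF h that] S unfolding config_set_def by blast
  then have "restrict h {1..n} \<in> {1..n} \<rightarrow>\<^sub>E torus"
    unfolding restrict_PiE_iff by blast
  moreover have "inj_on (restrict h {1..n}) {1..n}"
    using bij_betw_imp_inj_on[OF h] by (simp only: inj_on_restrict_eq)
  ultimately have "restrict h {1..n} \<in> topspace (ordered_config n)"
    unfolding topspace_ordered_config by blast
  moreover have "restrict h {1..n} ` {1..n} = S"
    using bij_betw_imp_surj_on[OF h] by simp
  ultimately show "S \<in> (\<lambda>x. x ` {1..n}) ` topspace (ordered_config n)"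
    by (metis imageI)
qed

lemma topspace_config: "topspace (config n) = (config_set n :: (complex ^ 'k) set set)"
proof
  show "topspace (config n) \<subseteq> (config_set n :: (complex ^ 'k) set set)"
    unfolding topspace_def by (auto simp: openin_config)
  have "{x \<in> topspace (ordered_config n). x ` {1..n} \<in> config_set n}
      = topspace (ordered_config n :: (nat \<Rightarrow> complex ^ 'k) topology)"
    using image_ordered_config by auto
  then have "openin (config n) (config_set n :: (complex ^ 'k) set set)"
    unfolding openin_config by (simp only: openin_topspace) simp
  then show "(config_set n :: (complex ^ 'k) set set) \<subseteq> topspace (config n)"
    by (rule openin_subset)
qed

lemma quotient_map_config:
  "quotient_map (ordered_config n) (config n) (\<lambda>x. x ` {1..n})"
  unfolding quotient_map_def topspace_config image_ordered_config openin_config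
  by (intro conjI allI impI refl) simp

definition n_valued_map :: "nat \<Rightarrow> (complex ^ 'k \<Rightarrow> (complex ^ 'k) set) \<Rightarrow> bool" where
  "n_valued_map n f \<longleftrightarrow> continuous_map (top_of_set torus) (config n) f"

definition cover_config :: "nat \<Rightarrow> (nat \<Rightarrow> real ^ 'k) topology" where
  "cover_config n = subtopology (product_topology (\<lambda>_. euclidean) {1..n})
     {x. \<forall>i\<in>{1..n}. \<forall>j\<in>{1..n}. i \<noteq> j \<longrightarrow> torus_cover (x i) \<noteq> torus_cover (x j)}"

definition config_cover :: "nat \<Rightarrow> (nat \<Rightarrow> real ^ 'k) \<Rightarrow> (complex ^ 'k) set" where
  "config_cover n x = (\<lambda>i. torus_cover (x i)) ` {1..n}"


section \<open>Lifts, induced morphisms, affine maps\<close>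

text \<open>In a lift \<open>F\<close>, the \<open>i\<close>-th lift-factor is \<open>\<lambda>t. F t i\<close>.\<close>

definition is_lift ::
  "nat \<Rightarrow> (complex ^ 'k \<Rightarrow> (complex ^ 'k) set) \<Rightarrow> (real ^ 'k \<Rightarrow> nat \<Rightarrow> real ^ 'k) \<Rightarrow> bool"
where
  "is_lift n f F \<longleftrightarrow> continuous_map euclidean (cover_config n) F \<and>
     (\<forall>t. config_cover n (F t) = f (torus_cover t))"

definition real_vec :: "int ^ 'k \<Rightarrow> real ^ 'k" where
  "real_vec z = (\<chi> j. of_int (z $ j))"

text \<open>\<open>\<psi>\<close> is the morphism induced by the lift \<open>F\<close>: here \<open>\<phi>\<^sub>i(z) = fst (\<psi> z) i\<close> and
  \<open>\<sigma>\<^sub>z = snd (\<psi> z)\<close>. By \<open>induced_morphism_unique\<close> below there is at most one such \<open>\<psi>\<close>.\<close>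

definition induced_morphism ::
  "nat \<Rightarrow> (real ^ 'k \<Rightarrow> nat \<Rightarrow> real ^ 'k) \<Rightarrow>
   (int ^ 'k \<Rightarrow> (nat \<Rightarrow> int ^ 'k) \<times> (nat \<Rightarrow> nat)) \<Rightarrow> bool"
where
  "induced_morphism n F \<psi> \<longleftrightarrow>
     \<psi> \<in> hom int_lattice (int_lattice_wr_sym n) \<and>
     (\<forall>i\<in>{1..n}. \<forall>t z.
        F (t + real_vec z) i = F t (inv' (snd (\<psi> z)) i) + real_vec (fst (\<psi> z) i))"

lemma torus_cover_add_real_vec: "torus_cover (t + real_vec z) = torus_cover t"
proof -
  have "exp (2 * complex_of_real pi * \<i> * complex_of_real (real_of_int m)) = 1" for m :: int
    using exp_integer_2pi[of "of_int m"] by (simp add: mult_ac)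
  then show ?thesis
    by (simp add: torus_cover_def real_vec_def vec_eq_iff distrib_left exp_add)
qed

lemma induced_morphism_unique:
  fixes F :: "real ^ 'k \<Rightarrow> nat \<Rightarrow> real ^ 'k"
  assumes lift: "is_lift n f F"
    and 1: "induced_morphism n F \<psi>" and 2: "induced_morphism n F \<psi>'"
  shows "\<psi> = \<psi>'"
proof
  fix z :: "int ^ 'k"
  obtain \<alpha> \<sigma> where a: "\<psi> z = (\<alpha>, \<sigma>)" by fastforce
  obtain \<beta> \<tau> where b: "\<psi>' z = (\<beta>, \<tau>)" by fastforce
  have "\<psi> z \<in> carrier (int_lattice_wr_sym n)" "\<psi>' z \<in> carrier (int_lattice_wr_sym n)"
    using 1 2 by (auto simp: induced_morphism_def hom_def int_lattice_def Pi_iff)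
  then have s: "\<sigma> permutes {1..n}" and t: "\<tau> permutes {1..n}"
    and ext: "\<alpha> \<in> extensional {1..n}" "\<beta> \<in> extensional {1..n}"
    by (auto simp: a b int_lattice_wr_sym_def sym_group_def PiE_def)
  have eq: "F 0 (inv' \<sigma> i) + real_vec (\<alpha> i) = F 0 (inv' \<tau> i) + real_vec (\<beta> i)"
    if "i \<in> {1..n}" for i
  proof -
    have "F (0 + real_vec z) i = F 0 (inv' \<sigma> i) + real_vec (\<alpha> i)"
      using 1 that a unfolding induced_morphism_def by (metis fst_conv snd_conv)
    moreover have "F (0 + real_vec z) i = F 0 (inv' \<tau> i) + real_vec (\<beta> i)"
      using 2 that b unfolding induced_morphism_def by (metis fst_conv snd_conv)
    ultimately show ?thesis by simp
  qed
  have F0: "F 0 \<in> topspace (cover_config n)"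
    using continuous_map_image_subset_topspace[of euclidean "cover_config n" F] lift
    unfolding is_lift_def by auto
  have inv: "inv' \<sigma> i = inv' \<tau> i" if i: "i \<in> {1..n}" for i
  proof -
    have "torus_cover (F 0 (inv' \<sigma> i)) = torus_cover (F 0 (inv' \<tau> i))"
      using arg_cong[OF eq[OF i], of torus_cover] by (simp only: torus_cover_add_real_vec)
    moreover have "inv' \<sigma> i \<in> {1..n}" "inv' \<tau> i \<in> {1..n}"
      using i permutes_in_image[OF permutes_inv[OF s]] permutes_in_image[OF permutes_inv[OF t]]
      by blast+
    ultimately show ?thesis
      using F0 unfolding cover_config_def topspace_subtopology by blast
  qed
  have "inv' \<sigma> = inv' \<tau>"
  proof
    fix i show "inv' \<sigma> i = inv' \<tau> i"
      using inv permutes_not_in[OF permutes_inv[OF s]] permutes_not_in[OF permutes_inv[OF t]]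
      by (cases "i \<in> {1..n}") auto
  qed
  then have "\<sigma> = \<tau>" using s t by (metis permutes_inv_inv)
  moreover have "\<alpha> = \<beta>"
  proof (rule extensionalityI[OF ext])
    fix i assume "i \<in> {1..n}"
    then have "real_vec (\<alpha> i) = real_vec (\<beta> i)" using eq inv by auto
    then show "\<alpha> i = \<beta> i" by (simp add: real_vec_def vec_eq_iff)
  qed
  ultimately show "\<psi> z = \<psi>' z" by (simp add: a b)
qed

definition affine_n_valued_map :: "nat \<Rightarrow> (complex ^ 'k \<Rightarrow> (complex ^ 'k) set) \<Rightarrow> bool" where
  "affine_n_valued_map n f \<longleftrightarrow> n_valued_map n f \<and>
     (\<exists>F. is_lift n f F \<and>
        (\<forall>i\<in>{1..n}. \<exists>(A :: real ^ 'k ^ 'k) a. \<forall>t. F t i = A *v t + a))"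

definition induced_by_affine ::
  "nat \<Rightarrow> (int ^ 'k \<Rightarrow> (nat \<Rightarrow> int ^ 'k) \<times> (nat \<Rightarrow> nat)) \<Rightarrow> bool"
where
  "induced_by_affine n \<psi> \<longleftrightarrow>
     (\<exists>f F. affine_n_valued_map n f \<and> is_lift n f F \<and> induced_morphism n F \<psi>)"


section \<open>Cycle decompositions\<close>

text \<open>A decomposition of a permutation of \<open>{1..n}\<close> into disjoint cycles, where the fixed points
  are listed as cycles of length one. \<open>cycle_of_list [i\<^sub>1, \<dots>, i\<^sub>m]\<close> maps \<open>i\<^sub>j\<close> to \<open>i\<^sub>j\<^sub>+\<^sub>1\<close> and
  \<open>i\<^sub>m\<close> to \<open>i\<^sub>1\<close>.\<close>

definition disjoint_cycle_decomposition :: "nat \<Rightarrow> (nat \<Rightarrow> nat) \<Rightarrow> nat list list \<Rightarrow> bool" where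
  "disjoint_cycle_decomposition n \<sigma> css \<longleftrightarrow>
     [] \<notin> set css \<and> distinct (concat css) \<and> set (concat css) = {1..n} \<and>
     \<sigma> = foldr (\<circ>) (map cycle_of_list css) id"

end

theory Submission
  imports Defs
begin

text \<open>
  Let \<open>F\<close> be a lift of an affine map inducing \<open>\<psi>\<close>, and suppose that \<open>\<phi>\<^sub>j(z) = w\<close> for all \<open>j\<close> in
  a non-trivial cycle of \<open>\<sigma> = \<sigma>\<^sub>z\<close>. Translating by \<open>z\<close> moves \<open>F\<^sub>i\<close> to \<open>F\<^bsub>\<sigma> i\<^esub>\<close> and adds \<open>w\<close>;
  doing so \<open>m\<close> times, where \<open>m > 0\<close> and \<open>\<sigma>\<^sup>m = id\<close>, gives \<open>F\<^sub>i(t + m z) = F\<^sub>i(t) + m w\<close>.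
  As \<open>F\<^sub>i\<close> is affine, its \<open>m\<close> increments along \<open>t, t + z, \<dots>, t + m z\<close> are equal, so that already
  \<open>F\<^sub>i(t + z) = F\<^sub>i(t) + w\<close>. But \<open>F\<^bsub>\<sigma> i\<^esub>(t + z) = F\<^sub>i(t) + w\<close> as well, so \<open>F\<^sub>i\<close> and
  \<open>F\<^bsub>\<sigma> i\<^esub>\<close> coincide at \<open>t + z\<close>, which is impossible for distinct factors of a lift
  (\<open>fixed_if_equal_translations\<close>).

  The lift \<open>F\<close> that induces \<open>\<psi>\<close> need not be the lift whose factors are known to be affine.
  However, by connectedness of \<open>\<real>\<^sup>k\<close>, each factor of one lift is an integer translate of a factor
  of any other (\<open>lift_factor_translate\<close>), hence the factors of all lifts are affine.
\<close>

lemma torus_cover_eq_imp_diff_Ints: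
  assumes "torus_cover x = torus_cover y"
  shows "(x - y) $ j \<in> \<int>"
proof -
  have "exp (2 * complex_of_real pi * \<i> * complex_of_real (x $ j))
      = exp (2 * complex_of_real pi * \<i> * complex_of_real (y $ j))"
    using arg_cong[OF assms, of "\<lambda>v. v $ j"] by (simp add: torus_cover_def)
  then obtain m :: int where
    "2 * complex_of_real pi * \<i> * complex_of_real (x $ j)
      = 2 * complex_of_real pi * \<i> * complex_of_real (y $ j) + (of_int (2 * m) * pi) * \<i>"
    unfolding exp_eq by auto
  then have "2 * pi * (x $ j) = 2 * pi * (y $ j) + 2 * of_int m * pi"
    by (auto simp: complex_eq_iff)
  then have "2 * pi * (x $ j - y $ j) = 2 * pi * of_int m"
    by (simp add: algebra_simps)
  then have "x $ j - y $ j = of_int m" by simp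
  then show ?thesis by simp
qed

lemma continuous_on_torus_cover:
  assumes "continuous_on S g"
  shows "continuous_on S (\<lambda>t. torus_cover (g t))"
  unfolding torus_cover_def by (intro continuous_intros assms)

lemma continuous_Ints_valued_constant:
  fixes g :: "'a::topological_space \<Rightarrow> real"
  assumes "connected S" "continuous_on S g" "\<And>t. t \<in> S \<Longrightarrow> g t \<in> \<int>"
  shows "g constant_on S"
proof (rule continuous_discrete_range_constant[OF assms(1,2)])
  fix x assume x: "x \<in> S"
  show "\<exists>e>0. \<forall>y. y \<in> S \<and> g y \<noteq> g x \<longrightarrow> e \<le> norm (g y - g x)"
  proof (intro exI[of _ 1] conjI allI impI)
    fix y assume y: "y \<in> S \<and> g y \<noteq> g x"
    then have "g y - g x \<in> \<int>" "g y - g x \<noteq> 0"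
      using assms(3) x by auto
    then show "1 \<le> norm (g y - g x)"
      using Ints_nonzero_abs_ge1 by force
  qed simp
qed

lemma lift_factor_continuous:
  assumes "is_lift n f F" "i \<in> {1..n}"
  shows "continuous_on UNIV (\<lambda>t. F t i)"
  using assms unfolding is_lift_def cover_config_def
  by (auto simp: continuous_map_in_subtopology continuous_map_componentwise)

lemma lift_factors_inj:
  assumes "is_lift n f F" "i \<in> {1..n}" "j \<in> {1..n}" "torus_cover (F t i) = torus_cover (F t j)"
  shows "i = j"
proof -
  have "F t \<in> topspace (cover_config n)"
    using assms(1) unfolding is_lift_def continuous_map_def by auto
  then show ?thesis
    using assms(2-4) unfolding cover_config_def topspace_subtopology by blast
qed

text \<open>
  At each point, the projection of \<open>F\<^sub>i\<close> to the torus agrees with that of exactly one \<open>G\<^sub>j\<close>, so the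
  sets on which this \<open>j\<close> is a given one form a finite partition of \<open>\<real>\<^sup>k\<close> into closed sets. By
  connectedness only one of them is non-empty; for this \<open>j\<close> the difference \<open>F\<^sub>i - G\<^sub>j\<close> is continuous
  with values in \<open>\<int>\<^sup>k\<close>, hence constant.
\<close>

lemma lift_factor_translate:
  fixes F G :: "real ^ 'k \<Rightarrow> nat \<Rightarrow> real ^ 'k"
  assumes F: "is_lift n f F" and G: "is_lift n f G" and i: "i \<in> {1..n}"
  obtains j c where "j \<in> {1..n}" "\<And>t. F t i = G t j + c"
proof -
  define U where "U j = {t. torus_cover (F t i) = torus_cover (G t j)}" for j
  have closed: "closed (U j)" if "j \<in> {1..n}" for j
    unfolding U_def
    by (intro closed_Collect_eq continuous_on_torus_cover lift_factor_continuous[OF F i]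
        lift_factor_continuous[OF G that])
  have cover: "\<exists>j\<in>{1..n}. t \<in> U j" for t
  proof -
    have "torus_cover (F t i) \<in> config_cover n (F t)"
      using i by (auto simp: config_cover_def)
    also have "config_cover n (F t) = config_cover n (G t)"
      using F G by (simp add: is_lift_def)
    finally show ?thesis by (auto simp: config_cover_def U_def)
  qed
  have disjoint: "j = l" if "j \<in> {1..n}" "l \<in> {1..n}" "t \<in> U j" "t \<in> U l" for j l t
    using lift_factors_inj[OF G that(1,2)] that(3,4) by (simp add: U_def)
  obtain j where j: "j \<in> {1..n}" "0 \<in> U j" using cover by blast
  have "closed (\<Union>l\<in>{1..n} - {j}. U l)"
    using closed by (intro closed_UN) auto
  moreover have "- U j = (\<Union>l\<in>{1..n} - {j}. U l)"
    using cover disjoint[OF j(1)] by blast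
  ultimately have "open (U j)" by (simp add: open_closed)
  then have U: "U j = UNIV"
    using clopen[of "U j"] closed[OF j(1)] j(2) by auto
  have "(\<lambda>t. (F t i - G t j) $ l) constant_on UNIV" for l
  proof (rule continuous_Ints_valued_constant)
    show "continuous_on UNIV (\<lambda>t. (F t i - G t j) $ l)"
      by (intro continuous_intros lift_factor_continuous[OF F i] lift_factor_continuous[OF G j(1)])
    show "(F t i - G t j) $ l \<in> \<int>" for t
      using U by (intro torus_cover_eq_imp_diff_Ints) (auto simp: U_def)
  qed (rule connected_UNIV)
  then have "(F t i - G t j) $ l = (F 0 i - G 0 j) $ l" for t l
    unfolding constant_on_def by (metis UNIV_I)
  then have "F t i - G t j = F 0 i - G 0 j" for t
    by (simp add: vec_eq_iff)
  then have "F t i = G t j + (F 0 i - G 0 j)" for t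
    by (metis add.commute diff_add_cancel)
  with j(1) show thesis by (rule that)
qed

lemma affine_lift_factor:
  fixes F :: "real ^ 'k \<Rightarrow> nat \<Rightarrow> real ^ 'k"
  assumes "affine_n_valued_map n f" "is_lift n f F" "i \<in> {1..n}"
  obtains A :: "real ^ 'k ^ 'k" and a where "\<And>t. F t i = A *v t + a"
proof -
  obtain G where G: "is_lift n f G"
    and aff: "\<forall>i\<in>{1..n}. \<exists>(A :: real ^ 'k ^ 'k) a. \<forall>t. G t i = A *v t + a"
    using assms(1) unfolding affine_n_valued_map_def by blast
  obtain j c where j: "j \<in> {1..n}" "\<And>t. F t i = G t j + c"
    using lift_factor_translate[OF assms(2) G assms(3)] by blast
  obtain A a where "\<And>t. G t j = A *v t + a" using aff j(1) by blast
  then have "F t i = A *v t + (a + c)" for t by (simp add: j(2) add.assoc)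
  then show thesis by (rule that)
qed

lemma induced_morphism_permutes:
  assumes "induced_morphism n F \<psi>"
  shows "snd (\<psi> z) permutes {1..n}"
proof -
  have "\<psi> z \<in> carrier (int_lattice_wr_sym n)"
    using assms by (auto simp: induced_morphism_def hom_def int_lattice_def Pi_iff)
  then show ?thesis by (auto simp: int_lattice_wr_sym_def sym_group_def)
qed

lemma induced_morphism_translate:
  assumes "induced_morphism n F \<psi>" "i \<in> {1..n}"
  shows "F (t + real_vec z) (snd (\<psi> z) i) = F t i + real_vec (fst (\<psi> z) (snd (\<psi> z) i))"
proof -
  have p: "snd (\<psi> z) permutes {1..n}" by (rule induced_morphism_permutes[OF assms(1)])
  have "snd (\<psi> z) i \<in> {1..n}" using permutes_in_image[OF p] assms(2) by blast
  then show ?thesis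
    using assms(1) permutes_inverses(2)[OF p, of i] unfolding induced_morphism_def by metis
qed

text \<open>
  The invariant set \<open>C\<close> stands for a union of cycles of \<open>\<sigma>\<^sub>z\<close>: on it, each translation by \<open>z\<close>
  contributes the same increment \<open>w\<close>, so that iterated translations can be added up.
\<close>

lemma fixed_if_equal_translations:
  fixes F :: "real ^ 'k \<Rightarrow> nat \<Rightarrow> real ^ 'k"
  assumes aff: "affine_n_valued_map n f" and lift: "is_lift n f F"
    and ind: "induced_morphism n F \<psi>"
    and C: "C \<subseteq> {1..n}" "snd (\<psi> z) ` C \<subseteq> C" and w: "\<And>j. j \<in> C \<Longrightarrow> fst (\<psi> z) j = w"
    and i: "i \<in> C"
  shows "snd (\<psi> z) i = i"
proof -
  let ?\<sigma> = "snd (\<psi> z)" and ?z = "real_vec z" and ?w = "real_vec w"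
  have orbit: "(?\<sigma> ^^ m) i \<in> C" for m
    using i C(2) by (induction m) auto
  have step: "F (t + ?z) (?\<sigma> j) = F t j + ?w" if "j \<in> C" for t j
  proof -
    have "j \<in> {1..n}" "?\<sigma> j \<in> C" using that C by blast+
    then show ?thesis using induced_morphism_translate[OF ind, of j t z] w by metis
  qed
  have iterate: "F (real m *\<^sub>R ?z) ((?\<sigma> ^^ m) i) = F 0 i + real m *\<^sub>R ?w" for m
  proof (induction m)
    case (Suc m)
    show ?case
      using step[OF orbit[of m], of "real m *\<^sub>R ?z"] Suc by (simp add: algebra_simps)
  qed simp
  obtain A :: "real ^ 'k ^ 'k" and a where A: "\<And>t. F t i = A *v t + a"
    using affine_lift_factor[OF aff lift] i C(1) by blast
  have "permutation ?\<sigma>"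
    using induced_morphism_permutes[OF ind] unfolding permutation_permutes by blast
  then obtain m where m: "?\<sigma> ^^ m = id" "m > 0"
    using permutation_is_nilpotent by blast
  \<comment> \<open>After \<open>m\<close> translations the index is back at \<open>i\<close>, so both sides are the total increment of
    the single affine map \<open>F\<^sub>i\<close> from \<open>0\<close> to \<open>m z\<close>.\<close>
  have "real m *\<^sub>R (A *v ?z) = real m *\<^sub>R ?w"
    using iterate[of m] m(1) by (simp add: A matrix_vector_mult_scaleR)
  then have "A *v ?z = ?w" using m(2) by simp
  then have "F (0 + ?z) i = F 0 i + ?w" by (simp add: A)
  then have "F (0 + ?z) (?\<sigma> i) = F (0 + ?z) i" using step[OF i, of 0] by simp
  moreover have "?\<sigma> i \<in> {1..n}" "i \<in> {1..n}" using i C by blast+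
  ultimately show ?thesis using lift_factors_inj[OF lift] by metis
qed

text \<open>
  The cycle \<open>cs\<close> sends \<open>i\<close> to an element of \<open>cs\<close> again, and all other factors of the product, being
  disjoint from \<open>cs\<close>, fix both \<open>i\<close> and its image.
\<close>

lemma cycle_product_apply:
  assumes "distinct (concat css)" "cs \<in> set css" "i \<in> set cs"
  shows "foldr (\<circ>) (map cycle_of_list css) id i = cycle_of_list cs i"
  using assms
proof (induction css)
  case (Cons ds css)
  let ?p = "foldr (\<circ>) (map cycle_of_list css) id"
  have outside: "foldr (\<circ>) (map cycle_of_list ess) id j = j"
    if "j \<notin> set (concat ess)" for ess :: "'a list list" and j
    using that by (induction ess) (auto simp: id_outside_supp)
  have unfold: "foldr (\<circ>) (map cycle_of_list (ds # css)) id i = cycle_of_list ds (?p i)"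
    by simp
  show ?case
  proof (cases "i \<in> set ds")
    case True
    then have "i \<notin> set (concat css)" using Cons.prems(1) by auto
    moreover from this have "cs = ds" using Cons.prems(2,3) by auto
    ultimately show ?thesis using outside[of i css] unfolding unfold by simp
  next
    case False
    then have cs: "cs \<in> set css" using Cons.prems(2,3) by auto
    have "cycle_of_list cs i \<in> set cs"
      using permutes_in_image[OF cycle_permutes] Cons.prems(3) by metis
    then have "cycle_of_list cs i \<notin> set ds" using Cons.prems(1) cs by auto
    then show ?thesis
      using Cons.IH[OF _ cs Cons.prems(3)] Cons.prems(1) unfolding unfold
      by (metis concat.simps(2) distinct_append id_outside_supp)
  qed
qed simp

theorem corollary3p1:
  fixes n :: nat
    and \<psi> :: "int ^ 'k \<Rightarrow> (nat \<Rightarrow> int ^ 'k) \<times> (nat \<Rightarrow> nat)"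
    and z :: "int ^ 'k"
    and css :: "nat list list" and cs :: "nat list"
  assumes "n \<ge> 1"
    and "\<psi> \<in> hom int_lattice (int_lattice_wr_sym n)"
    and "induced_by_affine n \<psi>"
    and "disjoint_cycle_decomposition n (snd (\<psi> z)) css"
    and "cs \<in> set css" and "length cs \<ge> 2"
  shows "\<not> (\<forall>i\<in>set cs. \<forall>j\<in>set cs. fst (\<psi> z) i = fst (\<psi> z) j)"
proof
  assume eq: "\<forall>i\<in>set cs. \<forall>j\<in>set cs. fst (\<psi> z) i = fst (\<psi> z) j"
  obtain f F where F: "affine_n_valued_map n f" "is_lift n f F" "induced_morphism n F \<psi>"
    using assms(3) unfolding induced_by_affine_def by blast
  have dist: "distinct (concat css)" and sub: "set cs \<subseteq> {1..n}"
    and \<sigma>: "snd (\<psi> z) = foldr (\<circ>) (map cycle_of_list css) id"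
    using assms(4,5) unfolding disjoint_cycle_decomposition_def by auto
  have apply_cycle: "snd (\<psi> z) i = cycle_of_list cs i" if "i \<in> set cs" for i
    unfolding \<sigma> by (rule cycle_product_apply[OF dist assms(5) that])
  have stable: "snd (\<psi> z) ` set cs \<subseteq> set cs"
    using apply_cycle permutes_in_image[OF cycle_permutes[of cs]] by auto
  obtain i j ds where cs: "cs = i # j # ds"
    using assms(6) by (metis Suc_le_length_iff numeral_2_eq_2)
  have "distinct cs" using dist assms(5) by (induction css) auto
  then have "i \<noteq> j" and "cycle_of_list cs i = j"
    using id_outside_supp[of i "j # ds"] unfolding cs by simp_all
  moreover have "snd (\<psi> z) i = i"
  proof (rule fixed_if_equal_translations[OF F sub stable])
    show i: "i \<in> set cs" by (simp add: cs)
    show "fst (\<psi> z) l = fst (\<psi> z) i" if "l \<in> set cs" for l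
      using eq that i by blast
  qed
  ultimately show False using apply_cycle[of i] cs by simp
qed

end
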